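(* (Stability and positivity for $d=2$.) Let $\{I^k_{i,j,n}\}$ be defined by the two-dimensional upwind scheme (S) described in the context. Suppose that the discretization parameters satisfy $$\frac{c^+\Delta t}{\Delta x_1}+\frac{c^+\Delta t}{\Delta x_2}\le 1\qquad\text{and}\qquad \left\|\frac{\partial^2\tilde p}{\partial\alpha^2}\right\|_\infty\Delta\theta^2\le\frac{12}{\pi}\mu^*.$$ Then $$\|I^k\|_\infty\le \|I_0\|_\infty+\|I_1\|_\infty+c^+\|q\|_\infty T,\qquad 0\le k\le T/\Delta t,$$ where $\|I^k\|_\infty:=\sup\{|I^k_{i,j,n}|:\ (x_{ij},\xi_n)\in X\cup\Gamma_-\}$. Moreover, if $q\ge 0$, $I_0\ge 0$ and $I_1\ge 0$ everywhere, then $I^k_{i,j,n}\ge 0$ for all $k,i,j,n$.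
   Context: Domain and data. Let $T>0$, $\Omega=(0,L_1)\times(0,L_2)\subset\mathbb{R}^2$, $X=\Omega\times S^1$, and $\Gamma_-=\{(x,\xi)\in\partial\Omega\times S^1:\ n(x)\cdot\xi<0\}$, where $n(x)$ is the outward unit normal at $x\in\partial\Omega$ (undefined at the four corners, which are not part of $\Gamma_-$ and do not enter the scheme). The functions $c,\mu_{\rm a},\mu_{\rm s}$ on $\Omega$ are measurable with $c(x)>0$, $\mu_{\rm a}(x)\ge0$, $\mu_{\rm s}(x)\ge0$, $\mu_{\rm s}\not\equiv0$, and $$c^+:=\sup_{x\in\Omega}c(x)<\infty,\qquad \mu^*:=\inf_{\{x:\ \mu_{\rm s}(x)\ne0\}}\frac{\mu_{\rm a}(x)}{\mu_{\rm s}(x)}>0.$$ The scattering kernel is $p(x;\xi,\xi')=\tilde p(x;\alpha)$, where $\alpha$ is the angle formed by $\xi,\xi'\in S^1$, and $\tilde p(x;\alpha)\ge0$ is, for each $x\in\Omega$, $2\pi$-periodic, even and of class $C^2$ in $\alpha$, with $\int_0^{2\pi}\tilde p(x;\alpha)\,d\alpha=1$ and $$\left\|\frac{\partial^2\tilde p}{\partial\alpha^2}\right\|_\infty:=\sup_{(x,\alpha)\in\Omega\times[0,2\pi]}\left|\frac{\partial^2\tilde p}{\partial\alpha^2}(x;\alpha)\right|<\infty.$$ The inputs $q(t,x,\xi)$ (for $(x,\xi)\in X$), $I_0(x,\xi)$ (for $(x,\xi)\in X$) and $I_1(t,x,\xi)$ (for $(x,\xi)\in\Gamma_-$) are real bounded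 measurable functions, with $t\in[0,T]$; $\|q\|_\infty,\|I_0\|_\infty,\|I_1\|_\infty$ denote their sup norms. Grid. For positive integers $M_1,M_2,M$ and $\Delta t>0$ put $\Delta x_1=L_1/M_1$, $\Delta x_2=L_2/M_2$, $\Delta\theta=2\pi/M$, $t_k=k\Delta t$, $x_{ij}=(i\Delta x_1,j\Delta x_2)$, $\xi_n=(\xi_{n,1},\xi_{n,2})=(\cos n\Delta\theta,\sin n\Delta\theta)$ for integers $k,i,j,n$ (with $n$ understood modulo $M$). Scheme (S). The numbers $I^k_{i,j,n}$ are determined by $$\frac{1}{c(x_{ij})}\frac{I^{k+1}_{i,j,n}-I^k_{i,j,n}}{\Delta t}=A_\Delta I^k_{i,j,n}-\Sigma_\Delta I^{k+1}_{i,j,n}+K_\Delta I^k_{i,j,n}+q(t_k,x_{ij},\xi_n),\quad 0\le k\le T/\Delta t-1,\ (x_{ij},\xi_n)\in X,$$ $$I^0_{i,j,n}=I_0(x_{ij},\xi_n),\quad (x_{ij},\xi_n)\in X;\qquad I^k_{i,j,n}=I_1(t_k,x_{ij},\xi_n),\quad 0\le k\le T/\Delta t,\ (x_{ij},\xi_n)\in\Gamma_-,$$ where $$A_\Delta I^k_{i,j,n}=-\xi_{n,1}\frac{I^k_{i+1,j,n}-I^k_{i-1,j,n}}{2\Delta x_1}+|\xi_{n,1}|\frac{I^k_{i+1,j,n}-2I^k_{i,j,n}+I^k_{i-1,j,n}}{2\Delta x_1}-\xi_{n,2}\frac{I^k_{i,j+1,n}-I^k_{i,j-1,n}}{2\Delta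 x_2}+|\xi_{n,2}|\frac{I^k_{i,j+1,n}-2I^k_{i,j,n}+I^k_{i,j-1,n}}{2\Delta x_2},$$ $$\Sigma_\Delta I^k_{i,j,n}=\{\mu_{\rm s}(x_{ij})+\mu_{\rm a}(x_{ij})\}I^k_{i,j,n},\qquad K_\Delta I^k_{i,j,n}=\mu_{\rm s}(x_{ij})\Delta\theta\sum_{\nu=0}^{M-1}p(x_{ij};\xi_n,\xi_\nu)I^k_{i,j,\nu}.$$ In $A_\Delta$, values at grid points outside $X\cup\Gamma_-$ occur only with total coefficient $0$ and are disregarded. *)

theory Defs
  imports "HOL-Analysis.Analysis"
begin

definition Omega :: "real \<Rightarrow> real \<Rightarrow> (real \<times> real) set" where
  "Omega L1 L2 = {0<..<L1} \<times> {0<..<L2}"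

definition phase_space :: "real \<Rightarrow> real \<Rightarrow> ((real \<times> real) \<times> (real \<times> real)) set" where
  "phase_space L1 L2 = Omega L1 L2 \<times> sphere 0 1"

text \<open>Outward unit normal on the four open sides of the rectangle; its value at the corners and
  off the boundary is irrelevant, see \<open>inflow\<close>.\<close>

definition outward_normal :: "real \<Rightarrow> real \<Rightarrow> real \<times> real \<Rightarrow> real \<times> real" where
  "outward_normal L1 L2 x =
     (if fst x = 0 then (-1, 0) else if fst x = L1 then (1, 0)
      else if snd x = 0 then (0, -1) else (0, 1))"

definition corners :: "real \<Rightarrow> real \<Rightarrow> (real \<times> real) set" where
  "corners L1 L2 = {0, L1} \<times> {0, L2}"

text \<open>The inflow boundary \<open>\<Gamma>\<^sub>-\<close>, which does not contain the corners.\<close>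

definition inflow :: "real \<Rightarrow> real \<Rightarrow> ((real \<times> real) \<times> (real \<times> real)) set" where
  "inflow L1 L2 = {(x, \<xi>). x \<in> frontier (Omega L1 L2) - corners L1 L2 \<and> \<xi> \<in> sphere 0 1 \<and>
     outward_normal L1 L2 x \<bullet> \<xi> < 0}"

definition dir :: "real \<Rightarrow> real \<times> real" where
  "dir \<theta> = (cos \<theta>, sin \<theta>)"

text \<open>Measurability on sets involving \<open>S\<^sup>1\<close> and the boundary is Lebesgue measurability with respect
  to arc length, expressed in the arc length coordinates \<open>\<theta>\<close> (for the direction) and \<open>s\<close> (along a
  side of the rectangle). Every Borel measurable function is measurable in this sense.\<close>

definition measurable_phase :: "real \<Rightarrow> real \<Rightarrow> (real \<times> real \<Rightarrow> real \<times> real \<Rightarrow> real) \<Rightarrow> bool" where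
  "measurable_phase L1 L2 f \<longleftrightarrow>
     (\<lambda>(x, \<theta>). f x (dir \<theta>)) \<in> borel_measurable (lebesgue_on (Omega L1 L2 \<times> {0..2 * pi}))"

definition measurable_time_phase ::
  "real \<Rightarrow> real \<Rightarrow> real \<Rightarrow> (real \<Rightarrow> real \<times> real \<Rightarrow> real \<times> real \<Rightarrow> real) \<Rightarrow> bool" where
  "measurable_time_phase T L1 L2 f \<longleftrightarrow>
     (\<lambda>(t, x, \<theta>). f t x (dir \<theta>))
       \<in> borel_measurable (lebesgue_on ({0..T} \<times> Omega L1 L2 \<times> {0..2 * pi}))"

definition measurable_time_inflow ::
  "real \<Rightarrow> real \<Rightarrow> real \<Rightarrow> (real \<Rightarrow> real \<times> real \<Rightarrow> real \<times> real \<Rightarrow> real) \<Rightarrow> bool" where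
  "measurable_time_inflow T L1 L2 f \<longleftrightarrow>
     (\<forall>\<gamma> \<in> {(\<lambda>s. (0, s)), (\<lambda>s. (L1, s)), (\<lambda>s. (s, 0)), (\<lambda>s. (s, L2))}.
       (\<lambda>(t, s, \<theta>). f t (\<gamma> s) (dir \<theta>))
         \<in> borel_measurable (lebesgue_on
              {(t, s, \<theta>). t \<in> {0..T} \<and> \<theta> \<in> {0..2 * pi} \<and> (\<gamma> s, dir \<theta>) \<in> inflow L1 L2}))"

text \<open>Inserting \<open>0\<close> only matters for \<open>S = {}\<close>: it fixes the convention that the supremum
  of the empty set of absolute values is \<open>0\<close>. The real-valued supremum is meaningful
  only for \<open>f\<close> bounded on \<open>S\<close>.\<close>

definition sup_norm :: "'a set \<Rightarrow> ('a \<Rightarrow> real) \<Rightarrow> real" where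
  "sup_norm S f = Sup (insert 0 ((\<lambda>s. \<bar>f s\<bar>) ` S))"

definition class_C2 :: "(real \<Rightarrow> real) \<Rightarrow> bool" where
  "class_C2 f \<longleftrightarrow> (\<forall>\<alpha>. f differentiable (at \<alpha>)) \<and> (\<forall>\<alpha>. deriv f differentiable (at \<alpha>)) \<and>
     continuous_on UNIV (deriv (deriv f))"

definition angle :: "real \<times> real \<Rightarrow> real \<times> real \<Rightarrow> real" where
  "angle \<xi> \<xi>' = arccos (\<xi> \<bullet> \<xi>' / (norm \<xi> * norm \<xi>'))"

definition scattering_kernel ::
  "(real \<times> real \<Rightarrow> real \<Rightarrow> real) \<Rightarrow> real \<times> real \<Rightarrow> real \<times> real \<Rightarrow> real \<times> real \<Rightarrow> real" where
  "scattering_kernel pt x \<xi> \<xi>' = pt x (angle \<xi> \<xi>')"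

definition grid_pt :: "real \<Rightarrow> real \<Rightarrow> int \<Rightarrow> int \<Rightarrow> real \<times> real" where
  "grid_pt dx1 dx2 i j = (real_of_int i * dx1, real_of_int j * dx2)"

definition grid_dir :: "real \<Rightarrow> nat \<Rightarrow> real \<times> real" where
  "grid_dir d\<theta> n = dir (real n * d\<theta>)"

text \<open>Grid functions are total functions of \<open>(i, j, n)\<close>. The index \<open>n\<close>, understood modulo \<open>M\<close>, is
  represented by \<open>n < M\<close>. The values at grid points outside \<open>X \<union> \<Gamma>\<^sub>-\<close> are arbitrary
  reals; in \<open>A_op\<close> their coefficients cancel.\<close>

definition A_op ::
  "real \<Rightarrow> real \<Rightarrow> real \<Rightarrow> (int \<Rightarrow> int \<Rightarrow> nat \<Rightarrow> real) \<Rightarrow> int \<Rightarrow> int \<Rightarrow> nat \<Rightarrow> real" where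
  "A_op dx1 dx2 d\<theta> u i j n =
     (let \<xi>1 = fst (grid_dir d\<theta> n); \<xi>2 = snd (grid_dir d\<theta> n) in
      - \<xi>1 * ((u (i + 1) j n - u (i - 1) j n) / (2 * dx1))
      + \<bar>\<xi>1\<bar> * ((u (i + 1) j n - 2 * u i j n + u (i - 1) j n) / (2 * dx1))
      - \<xi>2 * ((u i (j + 1) n - u i (j - 1) n) / (2 * dx2))
      + \<bar>\<xi>2\<bar> * ((u i (j + 1) n - 2 * u i j n + u i (j - 1) n) / (2 * dx2)))"

definition Sigma_op ::
  "real \<Rightarrow> real \<Rightarrow> (real \<times> real \<Rightarrow> real) \<Rightarrow> (real \<times> real \<Rightarrow> real) \<Rightarrow>
   (int \<Rightarrow> int \<Rightarrow> nat \<Rightarrow> real) \<Rightarrow> int \<Rightarrow> int \<Rightarrow> nat \<Rightarrow> real" where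
  "Sigma_op dx1 dx2 \<mu>s \<mu>a u i j n =
     (\<mu>s (grid_pt dx1 dx2 i j) + \<mu>a (grid_pt dx1 dx2 i j)) * u i j n"

definition K_op ::
  "real \<Rightarrow> real \<Rightarrow> real \<Rightarrow> nat \<Rightarrow> (real \<times> real \<Rightarrow> real) \<Rightarrow>
   (real \<times> real \<Rightarrow> real \<times> real \<Rightarrow> real \<times> real \<Rightarrow> real) \<Rightarrow>
   (int \<Rightarrow> int \<Rightarrow> nat \<Rightarrow> real) \<Rightarrow> int \<Rightarrow> int \<Rightarrow> nat \<Rightarrow> real" where
  "K_op dx1 dx2 d\<theta> M \<mu>s p u i j n =
     \<mu>s (grid_pt dx1 dx2 i j) * d\<theta> *
     (\<Sum>\<nu><M. p (grid_pt dx1 dx2 i j) (grid_dir d\<theta> n) (grid_dir d\<theta> \<nu>) * u i j \<nu>)"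

definition grid_on ::
  "real \<Rightarrow> real \<Rightarrow> real \<Rightarrow> nat \<Rightarrow> ((real \<times> real) \<times> (real \<times> real)) set \<Rightarrow> (int \<times> int \<times> nat) set" where
  "grid_on dx1 dx2 d\<theta> M S = {(i, j, n). n < M \<and> (grid_pt dx1 dx2 i j, grid_dir d\<theta> n) \<in> S}"

end

theory Submission
  imports Defs "HOL-Library.Periodic_Fun"
begin

text \<open>Solving the scheme for \<open>I k+1\<close> at an interior grid point expresses it through values of \<open>I k\<close>
  at the point itself and its upwind neighbours, which lie in \<open>X \<union> \<Gamma>\<^sub>-\<close>, with coefficients that are
  nonnegative by the CFL condition; the implicit absorption term then dominates the scattering
  sum as soon as \<open>\<Delta>\<theta> \<Sum>\<^sub>\<nu> p \<le> 1 + \<mu>\<^sup>*\<close>. The latter is a quadrature error estimate: for a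
  periodic integrand the trapezoidal rule is also the midpoint rule on shifted cells, and only the
  midpoint error constant \<open>1/24\<close> (rather than \<open>1/12\<close>) yields the factor \<open>12/\<pi>\<close> of the hypothesis.\<close>

section \<open>Quadrature of periodic functions\<close>

lemma deriv_periodic:
  fixes f :: "real \<Rightarrow> real"
  assumes "\<And>x. f (x + p) = f x"
  shows "deriv f (x + p) = deriv f x"
proof -
  have "(\<lambda>x. f (x + p)) = f" using assms by auto
  then show ?thesis unfolding deriv_def by (simp add: DERIV_shift)
qed

lemma periodic_shift_int:
  fixes f :: "real \<Rightarrow> 'a"
  assumes "\<And>x. f (x + p) = f x"
  shows "f (x + of_int n * p) = f x"
proof -
  interpret periodic_fun_simple f p by standard (rule assms)
  show ?thesis by (rule plus_of_int)
qed

text \<open>Translation by whole periods; this carries a bound assumed on \<open>{0..p}\<close> over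
  to the whole line.\<close>

lemma periodic_reduce:
  fixes f :: "real \<Rightarrow> 'a"
  assumes "p > 0" and "\<And>x. f (x + p) = f x"
  obtains y where "y \<in> {0..p}" and "f y = f x"
proof
  define n where "n = \<lfloor>x / p\<rfloor>"
  have "of_int n \<le> x / p" "x / p \<le> of_int n + 1" unfolding n_def by linarith+
  then show "x + of_int (- n) * p \<in> {0..p}" using \<open>p > 0\<close> by (simp add: field_simps)
  show "f (x + of_int (- n) * p) = f x" by (rule periodic_shift_int[of f, OF assms(2)])
qed

text \<open>Stands for one integration from 0 to s; iterating it replaces Taylor's formula in the
  midpoint estimate.\<close>

lemma nonneg_if_deriv_nonneg:
  fixes g g' :: "real \<Rightarrow> real"
  assumes "g 0 = 0" and "\<And>s. (g has_real_derivative g' s) (at s)" and "\<And>s. s \<ge> 0 \<Longrightarrow> g' s \<ge> 0"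
    and "s \<ge> 0"
  shows "g s \<ge> 0"
proof -
  have "g 0 \<le> g s"
    by (rule DERIV_nonneg_imp_nondecreasing[OF \<open>s \<ge> 0\<close>]) (use assms in blast)
  then show ?thesis using assms by simp
qed

text \<open>The increment of \<open>F\<close> is the integral of \<open>f\<close> over the cell of
  width h centred at a. The function F(a+s) - F(a-s) - 2 f(a) s + D s^3/3 and its first two
  derivatives in s vanish at s = 0, and its third derivative f''(a+s) + f''(a-s) + 2 D is
  nonnegative. Three integrations, from the third derivative upwards, give nonnegativity for s >=
  0.\<close>

lemma midpoint_rule_upper:
  fixes F f f' f'' :: "real \<Rightarrow> real"
  assumes F: "\<And>x. (F has_real_derivative f x) (at x)"
    and f: "\<And>x. (f has_real_derivative f' x) (at x)"
    and f': "\<And>x. (f' has_real_derivative f'' x) (at x)"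
    and D: "\<And>x. \<bar>f'' x\<bar> \<le> D"
    and "h \<ge> 0"
  shows "h * f a \<le> F (a + h / 2) - F (a - h / 2) + D * h ^ 3 / 24"
proof -
  note [derivative_intros] = DERIV_chain2[OF F] DERIV_chain2[OF f] DERIV_chain2[OF f']
  have g2: "f' (a + s) - f' (a - s) + 2 * D * s \<ge> 0" if "s \<ge> 0" for s
  proof (rule nonneg_if_deriv_nonneg[where s = s and g = "\<lambda>s. f' (a + s) - f' (a - s) + 2 * D * s"])
    show "((\<lambda>s. f' (a + s) - f' (a - s) + 2 * D * s) has_real_derivative
        f'' (a + s) + f'' (a - s) + 2 * D) (at s)" for s
      by (auto intro!: derivative_eq_intros)
    show "f'' (a + s) + f'' (a - s) + 2 * D \<ge> 0" for s
      using D[of "a + s"] D[of "a - s"] by linarith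
  qed (use that in auto)
  have g1: "f (a + s) + f (a - s) - 2 * f a + D * s\<^sup>2 \<ge> 0" if "s \<ge> 0" for s
  proof (rule nonneg_if_deriv_nonneg[where s = s and g = "\<lambda>s. f (a + s) + f (a - s) - 2 * f a + D * s\<^sup>2"])
    show "((\<lambda>s. f (a + s) + f (a - s) - 2 * f a + D * s\<^sup>2) has_real_derivative
        f' (a + s) - f' (a - s) + 2 * D * s) (at s)" for s
      by (auto intro!: derivative_eq_intros)
  qed (use g2 that in auto)
  have "F (a + s) - F (a - s) - 2 * f a * s + D * s ^ 3 / 3 \<ge> 0" if "s \<ge> 0" for s
  proof (rule nonneg_if_deriv_nonneg
      [where s = s and g = "\<lambda>s. F (a + s) - F (a - s) - 2 * f a * s + D * s ^ 3 / 3"])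
    show "((\<lambda>s. F (a + s) - F (a - s) - 2 * f a * s + D * s ^ 3 / 3) has_real_derivative
        f (a + s) + f (a - s) - 2 * f a + D * s\<^sup>2) (at s)" for s
      by (auto intro!: derivative_eq_intros)
  qed (use g1 that in auto)
  \<comment> \<open>At half the cell width, D s^3/3 becomes D h^3/24.\<close>
  from this[of "h / 2"] show ?thesis
    using \<open>h \<ge> 0\<close> by (simp add: power3_eq_cube algebra_simps)
qed

text \<open>The nodes are the midpoints of M cells of width h that tile an interval of length p
  starting at a - h/2. By periodicity the integral over this interval is J, wherever it starts, and
  the M cell errors D h^3/24 add up to p D h^2/24 because M h = p.\<close>

lemma periodic_quadrature_upper:
  fixes f :: "real \<Rightarrow> real"
  assumes C2: "class_C2 f" and per: "\<And>x. f (x + p) = f x" and "p > 0"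
    and int: "(f has_integral J) {0..p}"
    and D: "\<And>x. x \<in> {0..p} \<Longrightarrow> \<bar>deriv (deriv f) x\<bar> \<le> D"
    and h: "h = p / real M" and "M > 0"
  shows "h * (\<Sum>\<nu><M. f (a + real \<nu> * h)) \<le> J + p * D * h\<^sup>2 / 24"
proof -
  have df: "(f has_real_derivative deriv f x) (at x)"
    and ddf: "(deriv f has_real_derivative deriv (deriv f) x) (at x)" for x
    using C2 unfolding class_C2_def
    by (auto simp: DERIV_deriv_iff_real_differentiable)
  have D_all: "\<bar>deriv (deriv f) x\<bar> \<le> D" for x
  proof (rule periodic_reduce[of p "deriv (deriv f)" x])
    show "deriv (deriv f) (x + p) = deriv (deriv f) x" for x
      using per by (intro deriv_periodic)
  qed (use D \<open>p > 0\<close> in \<open>force+\<close>)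
  \<comment> \<open>An antiderivative on the whole line is taken because the shifted cells may leave
    \<open>{0..p}\<close>.\<close>
  have "\<exists>F. \<forall>x. -\<infinity> < ereal x \<longrightarrow> ereal x < \<infinity> \<longrightarrow> (F has_vector_derivative f x) (at x)"
    by (rule einterval_antiderivative) (use df DERIV_isCont in auto)
  then obtain F where F: "(F has_real_derivative f x) (at x)" for x
    by (auto simp: has_real_derivative_iff_has_vector_derivative)
  have shift: "F (x + p) - F x = J" for x
  proof -
    \<comment> \<open>The derivative is f(x+p) - f(x) = 0, so the increment of \<open>F\<close> over
      one period does not depend on its starting point.\<close>
    have "((\<lambda>x. F (x + p) - F x) has_real_derivative 0) (at x)" for x
      using DERIV_diff[OF F[of "x + p", THEN DERIV_shift[THEN iffD1]] F[of x]] per by simp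
    then have "F (x + p) - F x = F (0 + p) - F 0"
      using DERIV_isconst_all[of "\<lambda>x. F (x + p) - F x"] by blast
    moreover have "F p - F 0 = J"
    proof (rule has_integral_unique[OF _ int])
      show "(f has_integral F p - F 0) {0..p}"
        by (rule fundamental_theorem_of_calculus)
          (use \<open>p > 0\<close> F in \<open>auto simp: has_real_derivative_iff_has_vector_derivative
             intro: has_vector_derivative_at_within\<close>)
    qed
    ultimately show ?thesis by simp
  qed
  have "h \<ge> 0" and Mh: "real M * h = p" using h \<open>p > 0\<close> \<open>M > 0\<close> by auto
  \<comment> \<open>The cell edges lie half a step off the nodes: \<open>G \<nu>\<close> is
    \<open>F\<close> at the left edge of cell \<nu>, so the cell integrals telescope.\<close>
  define G where "G \<nu> = F (a - h / 2 + real \<nu> * h)" for \<nu>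
  have "h * (\<Sum>\<nu><M. f (a + real \<nu> * h)) = (\<Sum>\<nu><M. h * f (a + real \<nu> * h))"
    by (simp add: sum_distrib_left)
  also have "\<dots> \<le> (\<Sum>\<nu><M. (G (Suc \<nu>) - G \<nu>) + D * h ^ 3 / 24)"
  proof (rule sum_mono)
    fix \<nu>
    show "h * f (a + real \<nu> * h) \<le> (G (Suc \<nu>) - G \<nu>) + D * h ^ 3 / 24"
      using midpoint_rule_upper[OF F df ddf D_all \<open>h \<ge> 0\<close>, of "a + real \<nu> * h"]
      unfolding G_def by (simp add: algebra_simps)
  qed
  also have "\<dots> = G M - G 0 + real M * (D * h ^ 3 / 24)"
    by (simp add: sum.distrib sum_lessThan_telescope)
  also have "G M - G 0 = J"
    using shift[of "a - h / 2"] unfolding G_def Mh by simp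
  also have "real M * (D * h ^ 3 / 24) = p * D * h\<^sup>2 / 24"
    unfolding Mh[symmetric] by (simp add: power3_eq_cube power2_eq_square)
  finally show ?thesis .
qed

section \<open>The scattering kernel on the direction grid\<close>

lemma norm_dir [simp]: "norm (dir \<theta>) = 1"
  by (simp add: dir_def norm_prod_def)

text \<open>The arccos angle agrees with b - a only up to sign and a multiple of 2 pi, as both have
  the same cosine; evenness and periodicity remove the two ambiguities.\<close>

lemma scattering_kernel_dir:
  assumes per: "\<And>\<alpha>. pt x (\<alpha> + 2 * pi) = pt x \<alpha>" and even: "\<And>\<alpha>. pt x (- \<alpha>) = pt x \<alpha>"
  shows "scattering_kernel pt x (dir a) (dir b) = pt x (b - a)"
proof -
  have "dir a \<bullet> dir b = cos (b - a)" by (simp add: dir_def cos_diff algebra_simps)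
  then have "cos (angle (dir a) (dir b)) = cos (b - a)" by (simp add: angle_def)
  then obtain n where "n \<in> \<int>" and
    n: "angle (dir a) (dir b) = b - a + 2 * n * pi \<or> angle (dir a) (dir b) = - (b - a) + 2 * n * pi"
    unfolding cos_eq by metis
  then obtain m where "n = of_int m" by (auto elim: Ints_cases)
  then have "angle (dir a) (dir b) = b - a + of_int m * (2 * pi) \<or>
      angle (dir a) (dir b) = - (b - a) + of_int m * (2 * pi)"
    using n by (simp add: mult_ac)
  then show ?thesis
    unfolding scattering_kernel_def
    using periodic_shift_int[of "pt x", OF per] even by metis
qed

text \<open>The sum samples \<open>pt x\<close> at equispaced angles, shifted by the angle of
  direction n. The quadrature bound with period 2 pi and integral 1 has error 2 pi D d\<theta>^2/24,
  which is the term with pi/12.\<close>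

lemma scattering_sum_upper:
  assumes "\<And>\<alpha>. pt x (\<alpha> + 2 * pi) = pt x \<alpha>" and "\<And>\<alpha>. pt x (- \<alpha>) = pt x \<alpha>"
    and "class_C2 (pt x)" and "(pt x has_integral 1) {0..2 * pi}"
    and "\<And>\<alpha>. \<alpha> \<in> {0..2 * pi} \<Longrightarrow> \<bar>deriv (deriv (pt x)) \<alpha>\<bar> \<le> D"
    and "d\<theta> = 2 * pi / real M" and "M > 0"
  shows "d\<theta> * (\<Sum>\<nu><M. scattering_kernel pt x (grid_dir d\<theta> n) (grid_dir d\<theta> \<nu>))
           \<le> 1 + pi / 12 * (D * d\<theta>\<^sup>2)"
proof -
  have "d\<theta> * (\<Sum>\<nu><M. pt x (- (real n * d\<theta>) + real \<nu> * d\<theta>)) \<le> 1 + 2 * pi * D * d\<theta>\<^sup>2 / 24"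
    using assms by (intro periodic_quadrature_upper) auto
  then show ?thesis
    using assms(1,2) by (simp add: grid_dir_def scattering_kernel_dir mult_ac)
qed

section \<open>The upwind step\<close>

lemma frontier_Omega:
  assumes "L1 > 0" and "L2 > 0"
  shows "frontier (Omega L1 L2) = {0..L1} \<times> {0..L2} - Omega L1 L2"
  using assms unfolding frontier_def Omega_def
  by (simp add: closure_Times interior_open open_Times)

text \<open>Both ends of the interval are grid points, so one mesh step from an interior point
  cannot jump over the boundary. At the left end, a positive coordinate forces i >= 1.\<close>

lemma grid_left:
  assumes "dx = L / real N" "N > 0" "L > 0" "0 < real_of_int i * dx"
  shows "real_of_int (i - 1) * dx = 0 \<or> 0 < real_of_int (i - 1) * dx"
proof -
  have "dx > 0" using assms by simp
  then have "i > 0" using assms(4) by (simp add: zero_less_mult_iff)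
  then show ?thesis using \<open>dx > 0\<close> by (cases "i = 1") auto
qed

text \<open>Since L = N dx, a coordinate below L forces i <= N - 1.\<close>

lemma grid_right:
  assumes "dx = L / real N" "N > 0" "L > 0" "real_of_int i * dx < L"
  shows "real_of_int (i + 1) * dx = L \<or> real_of_int (i + 1) * dx < L"
proof -
  have "dx > 0" "L = real N * dx" using assms by simp_all
  then have "real_of_int i < real N" using assms(4) mult_less_cancel_right_pos by metis
  then have "i < int N" by (metis of_int_less_iff of_int_of_nat_eq)
  then have "real_of_int (i + 1) \<le> real_of_int (int N)" by (subst of_int_le_iff) simp
  then have "real_of_int (i + 1) \<le> real N" by simp
  then have "real_of_int (i + 1) * dx \<le> real N * dx" using assms by (intro mult_right_mono) auto
  also have "\<dots> = L" using assms by simp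
  finally show ?thesis by linarith
qed

lemma norm_grid_dir [simp]: "norm (grid_dir d\<theta> n) = 1"
  by (simp add: grid_dir_def)

text \<open>On an open side the product with the normal is one component of \<xi> up to sign, so
  inflow is a sign condition on that component. It is the sign for which an upwind neighbour can
  land on that side.\<close>

lemma inflow_sides:
  assumes "L1 > 0" "L2 > 0" and "norm \<xi> = 1"
  shows "0 < y \<Longrightarrow> y < L2 \<Longrightarrow> fst \<xi> > 0 \<Longrightarrow> ((0, y), \<xi>) \<in> inflow L1 L2"
    and "0 < y \<Longrightarrow> y < L2 \<Longrightarrow> fst \<xi> < 0 \<Longrightarrow> ((L1, y), \<xi>) \<in> inflow L1 L2"
    and "0 < x \<Longrightarrow> x < L1 \<Longrightarrow> snd \<xi> > 0 \<Longrightarrow> ((x, 0), \<xi>) \<in> inflow L1 L2"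
    and "0 < x \<Longrightarrow> x < L1 \<Longrightarrow> snd \<xi> < 0 \<Longrightarrow> ((x, L2), \<xi>) \<in> inflow L1 L2"
  using assms(3) unfolding inflow_def frontier_Omega[OF assms(1,2)] using assms(1,2)
  by (auto simp: corners_def outward_normal_def Omega_def inner_prod_def)

text \<open>A step against \<xi> stays inside or reaches the side through which \<xi> enters; the
  other coordinate remains interior, so no corner is met. For a vanishing component the point itself
  is taken, because a true neighbour could lie on a side to which \<xi> is tangential, outside
  \<open>inflow\<close>.\<close>

lemma upwind_neighbour_1:
  assumes L: "L1 > 0" "L2 > 0" and M: "M1 > 0" and dx: "dx1 = L1 / real M1"
    and G: "(i, j, n) \<in> grid_on dx1 dx2 d\<theta> M (phase_space L1 L2)"
    and i': "i' = (if fst (grid_dir d\<theta> n) > 0 then i - 1 else if fst (grid_dir d\<theta> n) < 0 then i + 1 else i)"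
  shows "(i', j, n) \<in> grid_on dx1 dx2 d\<theta> M (phase_space L1 L2 \<union> inflow L1 L2)"
proof -
  have "dx1 > 0" using dx L M by simp
  have i: "0 < real_of_int i * dx1" "real_of_int i * dx1 < L1" and nM: "n < M"
    and j: "0 < real_of_int j * dx2" "real_of_int j * dx2 < L2"
    using G by (auto simp: grid_on_def phase_space_def Omega_def grid_pt_def)
  have le: "real_of_int (i - 1) * dx1 < L1" "0 < real_of_int (i + 1) * dx1"
    using i \<open>dx1 > 0\<close> by (auto simp: algebra_simps)
  note unfolds = grid_on_def phase_space_def Omega_def grid_pt_def
  consider "fst (grid_dir d\<theta> n) > 0" | "fst (grid_dir d\<theta> n) < 0" | "fst (grid_dir d\<theta> n) = 0"
    by linarith
  then show ?thesis
  proof cases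
    case 1
    then have "i' = i - 1" using i' by simp
    then show ?thesis
      using grid_left[OF dx M L(1) i(1)] le(1) i j nM inflow_sides(1)[OF L norm_grid_dir[of d\<theta> n]] 1
      by (auto simp: unfolds simp del: of_int_diff)
  next
    case 2
    then have "i' = i + 1" using i' by simp
    then show ?thesis
      using grid_right[OF dx M L(1) i(2)] le(2) i j nM inflow_sides(2)[OF L norm_grid_dir[of d\<theta> n]] 2
      by (auto simp: unfolds simp del: of_int_add)
  next
    case 3
    then show ?thesis using i' i j nM by (simp add: unfolds)
  qed
qed

lemma upwind_neighbour_2:
  assumes L: "L1 > 0" "L2 > 0" and M: "M2 > 0" and dx: "dx2 = L2 / real M2"
    and G: "(i, j, n) \<in> grid_on dx1 dx2 d\<theta> M (phase_space L1 L2)"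
    and j': "j' = (if snd (grid_dir d\<theta> n) > 0 then j - 1 else if snd (grid_dir d\<theta> n) < 0 then j + 1 else j)"
  shows "(i, j', n) \<in> grid_on dx1 dx2 d\<theta> M (phase_space L1 L2 \<union> inflow L1 L2)"
proof -
  have "dx2 > 0" using dx L M by simp
  have i: "0 < real_of_int i * dx1" "real_of_int i * dx1 < L1" and nM: "n < M"
    and j: "0 < real_of_int j * dx2" "real_of_int j * dx2 < L2"
    using G by (auto simp: grid_on_def phase_space_def Omega_def grid_pt_def)
  have le: "real_of_int (j - 1) * dx2 < L2" "0 < real_of_int (j + 1) * dx2"
    using j \<open>dx2 > 0\<close> by (auto simp: algebra_simps)
  note unfolds = grid_on_def phase_space_def Omega_def grid_pt_def
  consider "snd (grid_dir d\<theta> n) > 0" | "snd (grid_dir d\<theta> n) < 0" | "snd (grid_dir d\<theta> n) = 0"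
    by linarith
  then show ?thesis
  proof cases
    case 1
    then have "j' = j - 1" using j' by simp
    then show ?thesis
      using grid_left[OF dx M L(2) j(1)] le(1) i j nM inflow_sides(3)[OF L norm_grid_dir[of d\<theta> n]] 1
      by (auto simp: unfolds simp del: of_int_diff)
  next
    case 2
    then have "j' = j + 1" using j' by simp
    then show ?thesis
      using grid_right[OF dx M L(2) j(2)] le(2) i j nM inflow_sides(4)[OF L norm_grid_dir[of d\<theta> n]] 2
      by (auto simp: unfolds simp del: of_int_add)
  next
    case 3
    then show ?thesis using j' i j nM by (simp add: unfolds)
  qed
qed

text \<open>The second difference is artificial diffusion that exactly cancels the downwind value of
  the central difference.\<close>

lemma upwind_difference:
  fixes \<xi> a b m dx :: real
  shows "- \<xi> * ((a - b) / (2 * dx)) + \<bar>\<xi>\<bar> * ((a - 2 * m + b) / (2 * dx)) =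
    \<bar>\<xi>\<bar> / dx * ((if \<xi> > 0 then b else if \<xi> < 0 then a else m) - m)"
  \<comment> \<open>For dx = 0 both sides are 0, since division by zero yields 0.\<close>
  by (cases "dx = 0") (auto simp: field_simps)

text \<open>Here the arbitrary values outside \<open>X \<union> \<Gamma>\<^sub>-\<close> drop out.
  The neighbours depend only on the signs of the components of the direction, so they are fixed
  before the grid function \<open>u\<close>.\<close>

lemma A_op_upwind:
  assumes "L1 > 0" "L2 > 0" "M1 > 0" "M2 > 0" "dx1 = L1 / real M1" "dx2 = L2 / real M2"
    and "(i, j, n) \<in> grid_on dx1 dx2 d\<theta> M (phase_space L1 L2)"
  obtains i' j' where "(i', j, n) \<in> grid_on dx1 dx2 d\<theta> M (phase_space L1 L2 \<union> inflow L1 L2)"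
    and "(i, j', n) \<in> grid_on dx1 dx2 d\<theta> M (phase_space L1 L2 \<union> inflow L1 L2)"
    and "\<And>u. A_op dx1 dx2 d\<theta> u i j n =
           \<bar>fst (grid_dir d\<theta> n)\<bar> / dx1 * (u i' j n - u i j n) +
           \<bar>snd (grid_dir d\<theta> n)\<bar> / dx2 * (u i j' n - u i j n)"
proof -
  define i' where "i' = (if fst (grid_dir d\<theta> n) > 0 then i - 1
    else if fst (grid_dir d\<theta> n) < 0 then i + 1 else i)"
  define j' where "j' = (if snd (grid_dir d\<theta> n) > 0 then j - 1
    else if snd (grid_dir d\<theta> n) < 0 then j + 1 else j)"
  have "A_op dx1 dx2 d\<theta> u i j n =
      \<bar>fst (grid_dir d\<theta> n)\<bar> / dx1 * (u i' j n - u i j n) +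
      \<bar>snd (grid_dir d\<theta> n)\<bar> / dx2 * (u i j' n - u i j n)" for u
  proof -
    have u: "u i' j n = (if fst (grid_dir d\<theta> n) > 0 then u (i - 1) j n
        else if fst (grid_dir d\<theta> n) < 0 then u (i + 1) j n else u i j n)"
      "u i j' n = (if snd (grid_dir d\<theta> n) > 0 then u i (j - 1) n
        else if snd (grid_dir d\<theta> n) < 0 then u i (j + 1) n else u i j n)"
      by (simp_all add: i'_def j'_def)
    show ?thesis
      using upwind_difference[of "fst (grid_dir d\<theta> n)" "u (i + 1) j n" "u (i - 1) j n" dx1 "u i j n"]
        upwind_difference[of "snd (grid_dir d\<theta> n)" "u i (j + 1) n" "u i (j - 1) n" dx2 "u i j n"]
      unfolding A_op_def Let_def u by linarith
  qed
  then show thesis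
    using that[of i' j'] upwind_neighbour_1[OF assms(1,2,3,5,7) i'_def]
      upwind_neighbour_2[OF assms(1,2,4,6,7) j'_def] by blast
qed

lemma abs_fst_grid_dir_le [simp]: "\<bar>fst (grid_dir d\<theta> n)\<bar> \<le> 1"
  and abs_snd_grid_dir_le [simp]: "\<bar>snd (grid_dir d\<theta> n)\<bar> \<le> 1"
  by (simp_all add: grid_dir_def dir_def)

text \<open>Here r is c dt, \<open>a1\<close> and \<open>a2\<close> are Courant numbers,
  \<open>u\<close>, \<open>v1\<close>, \<open>v2\<close> and \<open>z\<close> are old values and
  \<open>w\<close> is the new one. With R = 1 + r (\<sigma>s + \<sigma>a), the convex combination of
  \<open>u\<close>, \<open>v1\<close>, \<open>v2\<close> contributes at most B. Hypothesis
  \<open>\<kappa>\<close> keeps the explicit scattering gain below the implicit loss, so it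
  contributes at most (R - 1) B. The total R B + r Q is then divided by R >= 1.\<close>

lemma implicit_step_bound:
  fixes r :: real
  assumes eq: "(1 + r * (\<sigma>s + \<sigma>a)) * w = (1 - a1 - a2) * u + a1 * v1 + a2 * v2
      + r * \<sigma>s * (\<Sum>\<nu><M. \<kappa> \<nu> * z \<nu>) + r * s"
    and nn: "r \<ge> 0" "\<sigma>s \<ge> 0" "\<sigma>a \<ge> 0" "a1 \<ge> 0" "a2 \<ge> 0" "a1 + a2 \<le> 1" "\<And>\<nu>. \<kappa> \<nu> \<ge> 0"
    and \<kappa>: "\<sigma>s * (\<Sum>\<nu><M. \<kappa> \<nu>) \<le> \<sigma>s + \<sigma>a"
    and B: "\<bar>u\<bar> \<le> B" "\<bar>v1\<bar> \<le> B" "\<bar>v2\<bar> \<le> B" "\<And>\<nu>. \<nu> < M \<Longrightarrow> \<bar>z \<nu>\<bar> \<le> B" and Q: "\<bar>s\<bar> \<le> Q"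
  shows "\<bar>w\<bar> \<le> B + r * Q"
proof -
  define R where "R = 1 + r * (\<sigma>s + \<sigma>a)"
  have R: "R \<ge> 1" unfolding R_def using nn by simp
  have "B \<ge> 0" "Q \<ge> 0" using B(1) Q by linarith+
  have "\<bar>\<Sum>\<nu><M. \<kappa> \<nu> * z \<nu>\<bar> \<le> (\<Sum>\<nu><M. \<kappa> \<nu> * B)"
    by (rule order_trans[OF sum_abs], rule sum_mono)
      (use nn(7) B(4) in \<open>auto simp: abs_mult intro!: mult_left_mono\<close>)
  then have "r * \<sigma>s * \<bar>\<Sum>\<nu><M. \<kappa> \<nu> * z \<nu>\<bar> \<le> r * \<sigma>s * ((\<Sum>\<nu><M. \<kappa> \<nu>) * B)"
    using nn by (intro mult_left_mono) (auto simp: sum_distrib_right)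
  also have "\<dots> = r * B * (\<sigma>s * (\<Sum>\<nu><M. \<kappa> \<nu>))" by (simp add: mult_ac)
  also have "\<dots> \<le> r * B * (\<sigma>s + \<sigma>a)"
    using \<kappa> nn \<open>B \<ge> 0\<close> by (intro mult_left_mono) auto
  finally have K: "\<bar>r * \<sigma>s * (\<Sum>\<nu><M. \<kappa> \<nu> * z \<nu>)\<bar> \<le> (R - 1) * B"
    using nn unfolding R_def by (simp add: abs_mult mult_ac)
  have 1: "\<bar>(1 - a1 - a2) * u\<bar> \<le> (1 - a1 - a2) * B" "\<bar>a1 * v1\<bar> \<le> a1 * B" "\<bar>a2 * v2\<bar> \<le> a2 * B"
    "\<bar>r * s\<bar> \<le> r * Q"
    using nn B Q by (auto simp: abs_mult intro!: mult_left_mono)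
  have "R * \<bar>w\<bar> = \<bar>R * w\<bar>" using R by (simp add: abs_mult)
  also have "\<dots> \<le> (1 - a1 - a2) * B + a1 * B + a2 * B + (R - 1) * B + r * Q"
    using K 1 eq[folded R_def] by linarith
  also have "\<dots> = R * B + r * Q" by (simp add: algebra_simps)
  \<comment> \<open>R >= 1 also absorbs the source term: r Q <= R r Q.\<close>
  also have "\<dots> \<le> R * (B + r * Q)"
    using R mult_right_mono[of 1 R "r * Q"] nn \<open>Q \<ge> 0\<close> by (simp add: algebra_simps)
  finally show ?thesis using R by (simp add: mult_le_cancel_left)
qed

text \<open>Every term on the right is nonnegative, and the factor of \<open>w\<close> is
  positive.\<close>

lemma implicit_step_nonneg:
  fixes r :: real
  assumes eq: "(1 + r * (\<sigma>s + \<sigma>a)) * w = (1 - a1 - a2) * u + a1 * v1 + a2 * v2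
      + r * \<sigma>s * (\<Sum>\<nu><M. \<kappa> \<nu> * z \<nu>) + r * s"
    and nn: "r \<ge> 0" "\<sigma>s \<ge> 0" "\<sigma>a \<ge> 0" "a1 \<ge> 0" "a2 \<ge> 0" "a1 + a2 \<le> 1" "\<And>\<nu>. \<kappa> \<nu> \<ge> 0"
    and pos: "u \<ge> 0" "v1 \<ge> 0" "v2 \<ge> 0" "\<And>\<nu>. \<nu> < M \<Longrightarrow> z \<nu> \<ge> 0" "s \<ge> 0"
  shows "w \<ge> 0"
proof -
  have "(1 + r * (\<sigma>s + \<sigma>a)) * w \<ge> 0"
    unfolding eq using nn pos by (auto intro!: add_nonneg_nonneg mult_nonneg_nonneg sum_nonneg)
  moreover have "1 + r * (\<sigma>s + \<sigma>a) > 0" using nn by (simp add: add_pos_nonneg)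
  ultimately show ?thesis by (simp add: zero_le_mult_iff)
qed

section \<open>Supremum norms of bounded functions\<close>

lemma bdd_above_abs_image:
  fixes f :: "'a \<Rightarrow> real"
  assumes "bounded (f ` S)"
  shows "bdd_above (insert 0 ((\<lambda>s. \<bar>f s\<bar>) ` S))"
proof -
  obtain b where "\<forall>y \<in> f ` S. \<bar>y\<bar> \<le> b"
    using assms by (auto simp: bounded_iff)
  then show ?thesis by (auto intro!: bdd_aboveI2[where M = b])
qed

lemma sup_norm_upper:
  assumes "bounded (f ` S)" and "s \<in> S"
  shows "\<bar>f s\<bar> \<le> sup_norm S f"
  unfolding sup_norm_def using assms by (intro cSup_upper bdd_above_abs_image) auto

lemma sup_norm_nonneg:
  assumes "bounded (f ` S)"
  shows "0 \<le> sup_norm S f"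
  unfolding sup_norm_def using assms by (intro cSup_upper bdd_above_abs_image) auto

lemma sup_norm_least:
  assumes "b \<ge> 0" and "\<And>s. s \<in> S \<Longrightarrow> \<bar>f s\<bar> \<le> b"
  shows "sup_norm S f \<le> b"
  unfolding sup_norm_def using assms by (intro cSup_least) auto

theorem theorem2p2:
  fixes T L1 L2 dt dx1 dx2 d\<theta> cp \<mu>star :: real
    and M1 M2 M :: nat
    and c \<mu>a \<mu>s :: "real \<times> real \<Rightarrow> real"
    and pt :: "real \<times> real \<Rightarrow> real \<Rightarrow> real"
    and q I1 :: "real \<Rightarrow> real \<times> real \<Rightarrow> real \<times> real \<Rightarrow> real"
    and I0 :: "real \<times> real \<Rightarrow> real \<times> real \<Rightarrow> real"
    and I :: "nat \<Rightarrow> int \<Rightarrow> int \<Rightarrow> nat \<Rightarrow> real"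
  assumes "T > 0" and "L1 > 0" and "L2 > 0"
    \<comment> \<open>coefficients\<close>
    and "c \<in> borel_measurable (lebesgue_on (Omega L1 L2))"
    and "\<mu>a \<in> borel_measurable (lebesgue_on (Omega L1 L2))"
    and "\<mu>s \<in> borel_measurable (lebesgue_on (Omega L1 L2))"
    and "\<forall>x\<in>Omega L1 L2. c x > 0 \<and> \<mu>a x \<ge> 0 \<and> \<mu>s x \<ge> 0"
    and "\<exists>x\<in>Omega L1 L2. \<mu>s x \<noteq> 0"
    and "bdd_above (c ` Omega L1 L2)"
    and "cp = (SUP x\<in>Omega L1 L2. c x)"
    and "\<mu>star = (INF x\<in>{x \<in> Omega L1 L2. \<mu>s x \<noteq> 0}. \<mu>a x / \<mu>s x)"
    and "\<mu>star > 0"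
    \<comment> \<open>scattering kernel\<close>
    and "\<forall>x\<in>Omega L1 L2. (\<forall>\<alpha>. pt x \<alpha> \<ge> 0) \<and> (\<forall>\<alpha>. pt x (\<alpha> + 2 * pi) = pt x \<alpha>) \<and>
           (\<forall>\<alpha>. pt x (- \<alpha>) = pt x \<alpha>) \<and> class_C2 (pt x) \<and> (pt x has_integral 1) {0..2 * pi}"
    and "bounded ((\<lambda>(x, \<alpha>). deriv (deriv (pt x)) \<alpha>) ` (Omega L1 L2 \<times> {0..2 * pi}))"
    \<comment> \<open>inputs\<close>
    and "measurable_time_phase T L1 L2 q"
    and "bounded ((\<lambda>(t, x, \<xi>). q t x \<xi>) ` ({0..T} \<times> phase_space L1 L2))"
    and "measurable_phase L1 L2 I0"
    and "bounded ((\<lambda>(x, \<xi>). I0 x \<xi>) ` phase_space L1 L2)"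
    and "measurable_time_inflow T L1 L2 I1"
    and "bounded ((\<lambda>(t, x, \<xi>). I1 t x \<xi>) ` ({0..T} \<times> inflow L1 L2))"
    \<comment> \<open>grid\<close>
    and "M1 > 0" and "M2 > 0" and "M > 0" and "dt > 0"
    and "dx1 = L1 / real M1" and "dx2 = L2 / real M2" and "d\<theta> = 2 * pi / real M"
    \<comment> \<open>scheme\<close>
    and "\<forall>k i j n. real k \<le> T / dt - 1 \<and> (i, j, n) \<in> grid_on dx1 dx2 d\<theta> M (phase_space L1 L2) \<longrightarrow>
           1 / c (grid_pt dx1 dx2 i j) * ((I (Suc k) i j n - I k i j n) / dt) =
             A_op dx1 dx2 d\<theta> (I k) i j n - Sigma_op dx1 dx2 \<mu>s \<mu>a (I (Suc k)) i j n
             + K_op dx1 dx2 d\<theta> M \<mu>s (scattering_kernel pt) (I k) i j n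
             + q (real k * dt) (grid_pt dx1 dx2 i j) (grid_dir d\<theta> n)"
    and "\<forall>i j n. (i, j, n) \<in> grid_on dx1 dx2 d\<theta> M (phase_space L1 L2) \<longrightarrow>
           I 0 i j n = I0 (grid_pt dx1 dx2 i j) (grid_dir d\<theta> n)"
    and "\<forall>k i j n. real k \<le> T / dt \<and> (i, j, n) \<in> grid_on dx1 dx2 d\<theta> M (inflow L1 L2) \<longrightarrow>
           I k i j n = I1 (real k * dt) (grid_pt dx1 dx2 i j) (grid_dir d\<theta> n)"
    \<comment> \<open>discretization conditions\<close>
    and "cp * dt / dx1 + cp * dt / dx2 \<le> 1"
    and "sup_norm (Omega L1 L2 \<times> {0..2 * pi}) (\<lambda>(x, \<alpha>). deriv (deriv (pt x)) \<alpha>) * d\<theta>\<^sup>2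
           \<le> 12 / pi * \<mu>star"
  shows "(\<forall>k. real k \<le> T / dt \<longrightarrow>
            sup_norm (grid_on dx1 dx2 d\<theta> M (phase_space L1 L2 \<union> inflow L1 L2))
                     (\<lambda>(i, j, n). I k i j n)
              \<le> sup_norm (phase_space L1 L2) (\<lambda>(x, \<xi>). I0 x \<xi>)
                + sup_norm ({0..T} \<times> inflow L1 L2) (\<lambda>(t, x, \<xi>). I1 t x \<xi>)
                + cp * sup_norm ({0..T} \<times> phase_space L1 L2) (\<lambda>(t, x, \<xi>). q t x \<xi>) * T) \<and>
         ((\<forall>(t, x, \<xi>) \<in> {0..T} \<times> phase_space L1 L2. q t x \<xi> \<ge> 0) \<and>
          (\<forall>(x, \<xi>) \<in> phase_space L1 L2. I0 x \<xi> \<ge> 0) \<and>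
          (\<forall>(t, x, \<xi>) \<in> {0..T} \<times> inflow L1 L2. I1 t x \<xi> \<ge> 0) \<longrightarrow>
          (\<forall>k i j n. real k \<le> T / dt \<and>
             (i, j, n) \<in> grid_on dx1 dx2 d\<theta> M (phase_space L1 L2 \<union> inflow L1 L2) \<longrightarrow>
             I k i j n \<ge> 0))"
proof -
  note T = assms(1) and L1 = assms(2) and L2 = assms(3)
    and coeff = assms(7) and c_bdd = assms(9) and cp = assms(10) and \<mu>star = assms(11,12)
    and kernel = assms(13) and ddpt_bdd = assms(14) and q_bdd = assms(16)
    and I0_bdd = assms(18) and I1_bdd = assms(20)
    and M1 = assms(21) and M2 = assms(22) and M = assms(23) and dt = assms(24)
    and dx1 = assms(25) and dx2 = assms(26) and d\<theta> = assms(27)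
    and scheme = assms(28) and init = assms(29) and bdry = assms(30)
    and cfl = assms(31) and angular = assms(32)

  \<comment> \<open>Norms of the data and pointwise bounds on the coefficients\<close>
  define D where "D = sup_norm (Omega L1 L2 \<times> {0..2 * pi}) (\<lambda>(x, \<alpha>). deriv (deriv (pt x)) \<alpha>)"
  define N0 where "N0 = sup_norm (phase_space L1 L2) (\<lambda>(x, \<xi>). I0 x \<xi>)"
  define N1 where "N1 = sup_norm ({0..T} \<times> inflow L1 L2) (\<lambda>(t, x, \<xi>). I1 t x \<xi>)"
  define Q where "Q = sup_norm ({0..T} \<times> phase_space L1 L2) (\<lambda>(t, x, \<xi>). q t x \<xi>)"
  let ?X = "grid_on dx1 dx2 d\<theta> M (phase_space L1 L2)"
  let ?G = "grid_on dx1 dx2 d\<theta> M (phase_space L1 L2 \<union> inflow L1 L2)"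
  let ?x = "grid_pt dx1 dx2"
  have N: "N0 \<ge> 0" "N1 \<ge> 0" "Q \<ge> 0"
    unfolding N0_def N1_def Q_def using sup_norm_nonneg I0_bdd I1_bdd q_bdd by auto
  have I0_le: "\<bar>I0 x \<xi>\<bar> \<le> N0" if "(x, \<xi>) \<in> phase_space L1 L2" for x \<xi>
    using sup_norm_upper[OF I0_bdd that] unfolding N0_def by simp
  have I1_le: "\<bar>I1 t x \<xi>\<bar> \<le> N1" if "t \<in> {0..T}" "(x, \<xi>) \<in> inflow L1 L2" for t x \<xi>
    using sup_norm_upper[OF I1_bdd, of "(t, x, \<xi>)"] that unfolding N1_def by simp
  have q_le: "\<bar>q t x \<xi>\<bar> \<le> Q" if "t \<in> {0..T}" "(x, \<xi>) \<in> phase_space L1 L2" for t x \<xi>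
    using sup_norm_upper[OF q_bdd, of "(t, x, \<xi>)"] that unfolding Q_def by simp
  have c_le: "c x \<le> cp" if "x \<in> Omega L1 L2" for x
    unfolding cp using c_bdd that by (rule cSUP_upper2) simp
  \<comment> \<open>The centre of the rectangle witnesses that the domain is nonempty, so
    \<open>cp\<close> dominates some positive value of c.\<close>
  have "(L1 / 2, L2 / 2) \<in> Omega L1 L2" using L1 L2 by (simp add: Omega_def)
  then have "cp > 0" using coeff c_le by (meson less_le_trans)
  have "dx1 > 0" "dx2 > 0" "d\<theta> > 0" using dx1 dx2 d\<theta> L1 L2 M1 M2 M by auto
  \<comment> \<open>The product form also covers points with vanishing \<open>\<mu>s\<close>, which
    the infimum leaves out.\<close>
  have \<mu>: "\<mu>s x * \<mu>star \<le> \<mu>a x" if x: "x \<in> Omega L1 L2" for x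
  proof (cases "\<mu>s x = 0")
    case False
    have "bdd_below ((\<lambda>x. \<mu>a x / \<mu>s x) ` {x \<in> Omega L1 L2. \<mu>s x \<noteq> 0})"
      using coeff by (intro bdd_belowI2[of _ 0]) auto
    then have "\<mu>star \<le> \<mu>a x / \<mu>s x"
      unfolding \<mu>star(1) by (rule cINF_lower) (use x False in simp)
    moreover have "\<mu>s x > 0" using coeff x False by force
    ultimately show ?thesis by (simp add: field_simps)
  qed (use coeff x in simp)

  \<comment> \<open>Scattering weights and Courant numbers\<close>
  define \<kappa> where "\<kappa> i j n \<nu> = d\<theta> * scattering_kernel pt (?x i j) (grid_dir d\<theta> n) (grid_dir d\<theta> \<nu>)"
    for i j n \<nu>
  have inX: "?x i j \<in> Omega L1 L2" "n < M" "(?x i j, grid_dir d\<theta> n) \<in> phase_space L1 L2"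
    if "(i, j, n) \<in> ?X" for i j n
    using that by (auto simp: grid_on_def phase_space_def)
  have \<kappa>_nonneg: "\<kappa> i j n \<nu> \<ge> 0" if "(i, j, n) \<in> ?X" for i j n \<nu>
    unfolding \<kappa>_def scattering_kernel_def using inX(1)[OF that] kernel \<open>d\<theta> > 0\<close> by simp
  have \<kappa>_sum: "\<mu>s (?x i j) * (\<Sum>\<nu><M. \<kappa> i j n \<nu>) \<le> \<mu>s (?x i j) + \<mu>a (?x i j)"
    if "(i, j, n) \<in> ?X" for i j n
  proof -
    note x = inX(1)[OF that]
    have "\<bar>deriv (deriv (pt (?x i j))) \<alpha>\<bar> \<le> D" if "\<alpha> \<in> {0..2 * pi}" for \<alpha>
      using sup_norm_upper[OF ddpt_bdd, of "(?x i j, \<alpha>)"] x that unfolding D_def by simp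
    then have "(\<Sum>\<nu><M. \<kappa> i j n \<nu>) \<le> 1 + pi / 12 * (D * d\<theta>\<^sup>2)"
      unfolding \<kappa>_def sum_distrib_left[symmetric]
      using kernel x by (intro scattering_sum_upper d\<theta> M) auto
    \<comment> \<open>The angular condition enters here: the quadrature error pi/12 D d\<theta>^2 is
      at most \<mu>star, so the weights sum to at most 1 + \<mu>star.\<close>
    also have "pi / 12 * (D * d\<theta>\<^sup>2) \<le> pi / 12 * (12 / pi * \<mu>star)"
      using angular unfolding D_def by (intro mult_left_mono) auto
    finally have "\<mu>s (?x i j) * (\<Sum>\<nu><M. \<kappa> i j n \<nu>) \<le> \<mu>s (?x i j) * (1 + \<mu>star)"
      using coeff x by (intro mult_left_mono) auto
    then show ?thesis using \<mu>[OF x] by (simp add: algebra_simps)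
  qed
  define a1 where "a1 i j n = c (?x i j) * dt * (\<bar>fst (grid_dir d\<theta> n)\<bar> / dx1)" for i j n
  define a2 where "a2 i j n = c (?x i j) * dt * (\<bar>snd (grid_dir d\<theta> n)\<bar> / dx2)" for i j n
  have a: "a1 i j n \<ge> 0" "a2 i j n \<ge> 0" "a1 i j n + a2 i j n \<le> 1" if "(i, j, n) \<in> ?X" for i j n
  proof -
    note x = inX(1)[OF that]
    have c: "0 \<le> c (?x i j) * dt" "c (?x i j) * dt \<le> cp * dt"
      using coeff x dt c_le[OF x] by (auto intro: less_imp_le)
    then show "a1 i j n \<ge> 0" "a2 i j n \<ge> 0"
      unfolding a1_def a2_def using \<open>dx1 > 0\<close> \<open>dx2 > 0\<close> by auto
    \<comment> \<open>Each direction component is at most 1 in absolute value and c <= cp, so the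
      CFL condition bounds the sum of both Courant numbers and leaves the point itself a nonnegative
      weight.\<close>
    have "c (?x i j) * dt * (\<bar>\<xi>\<bar> / dx) \<le> cp * dt * (1 / dx)" if "\<bar>\<xi>\<bar> \<le> 1" "dx > 0" for \<xi> dx :: real
      by (rule mult_mono[OF c(2)]) (use c that in \<open>auto intro: divide_right_mono\<close>)
    then have "a1 i j n \<le> cp * dt * (1 / dx1)" "a2 i j n \<le> cp * dt * (1 / dx2)"
      unfolding a1_def a2_def using \<open>dx1 > 0\<close> \<open>dx2 > 0\<close> by simp_all
    then show "a1 i j n + a2 i j n \<le> 1" using cfl by simp
  qed
  \<comment> \<open>The scheme times c dt, with the implicit terms collected on the left, in the
    form that the one-step lemmas expect. The range of k is the scheme's k <= T/dt - 1, written for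
    the new level.\<close>
  have step: "\<exists>i' j'. (i', j, n) \<in> ?G \<and> (i, j', n) \<in> ?G \<and>
      (1 + c (?x i j) * dt * (\<mu>s (?x i j) + \<mu>a (?x i j))) * I (Suc k) i j n =
        (1 - a1 i j n - a2 i j n) * I k i j n + a1 i j n * I k i' j n + a2 i j n * I k i j' n
        + c (?x i j) * dt * \<mu>s (?x i j) * (\<Sum>\<nu><M. \<kappa> i j n \<nu> * I k i j \<nu>)
        + c (?x i j) * dt * q (real k * dt) (?x i j) (grid_dir d\<theta> n)"
    if X: "(i, j, n) \<in> ?X" and k: "real (Suc k) \<le> T / dt" for k i j n
  proof -
    obtain i' j' where nb: "(i', j, n) \<in> ?G" "(i, j', n) \<in> ?G"
      and A: "\<And>u. A_op dx1 dx2 d\<theta> u i j n =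
        \<bar>fst (grid_dir d\<theta> n)\<bar> / dx1 * (u i' j n - u i j n) +
        \<bar>snd (grid_dir d\<theta> n)\<bar> / dx2 * (u i j' n - u i j n)"
      using A_op_upwind[OF L1 L2 M1 M2 dx1 dx2 X] by metis
    define r where "r = c (?x i j) * dt"
    define S where "S = (\<Sum>\<nu><M. \<kappa> i j n \<nu> * I k i j \<nu>)"
    define b1 where "b1 = \<bar>fst (grid_dir d\<theta> n)\<bar> / dx1"
    define b2 where "b2 = \<bar>snd (grid_dir d\<theta> n)\<bar> / dx2"
    have K: "K_op dx1 dx2 d\<theta> M \<mu>s (scattering_kernel pt) (I k) i j n = \<mu>s (?x i j) * S"
      unfolding K_op_def S_def \<kappa>_def by (simp add: sum_distrib_left mult_ac)
    have "r > 0" unfolding r_def using coeff inX(1)[OF X] dt by simp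
    have "1 / c (?x i j) * ((I (Suc k) i j n - I k i j n) / dt) =
        A_op dx1 dx2 d\<theta> (I k) i j n - Sigma_op dx1 dx2 \<mu>s \<mu>a (I (Suc k)) i j n
        + K_op dx1 dx2 d\<theta> M \<mu>s (scattering_kernel pt) (I k) i j n
        + q (real k * dt) (?x i j) (grid_dir d\<theta> n)"
      using scheme X k by simp
    then have "(I (Suc k) i j n - I k i j n) / r =
        b1 * (I k i' j n - I k i j n) + b2 * (I k i j' n - I k i j n)
        - (\<mu>s (?x i j) + \<mu>a (?x i j)) * I (Suc k) i j n + \<mu>s (?x i j) * S
        + q (real k * dt) (?x i j) (grid_dir d\<theta> n)"
      unfolding A K Sigma_op_def b1_def b2_def r_def by simp
    then have "I (Suc k) i j n - I k i j n =
        r * (b1 * (I k i' j n - I k i j n) + b2 * (I k i j' n - I k i j n)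
        - (\<mu>s (?x i j) + \<mu>a (?x i j)) * I (Suc k) i j n + \<mu>s (?x i j) * S
        + q (real k * dt) (?x i j) (grid_dir d\<theta> n))"
      using \<open>r > 0\<close> by (metis nonzero_eq_divide_eq less_irrefl mult.commute)
    then have "(1 + r * (\<mu>s (?x i j) + \<mu>a (?x i j))) * I (Suc k) i j n =
        (1 - r * b1 - r * b2) * I k i j n + r * b1 * I k i' j n + r * b2 * I k i j' n
        + r * \<mu>s (?x i j) * S + r * q (real k * dt) (?x i j) (grid_dir d\<theta> n)"
      by (simp add: algebra_simps)
    then show ?thesis
      using nb unfolding a1_def a2_def b1_def b2_def r_def S_def by blast
  qed

  \<comment> \<open>Induction over the time levels\<close>
  have G_cases: "(i, j, n) \<in> ?X \<or> (i, j, n) \<in> grid_on dx1 dx2 d\<theta> M (inflow L1 L2)"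
    if "(i, j, n) \<in> ?G" for i j n
    using that by (auto simp: grid_on_def)
  \<comment> \<open>The scattering sum runs through all directions at a fixed interior point; these
    stay in the phase space, so the induction hypothesis covers every summand.\<close>
  have XG: "(i, j, \<nu>) \<in> ?G" if "(i, j, n) \<in> ?X" "\<nu> < M" for i j n \<nu>
    using that by (auto simp: grid_on_def phase_space_def grid_dir_def)
  \<comment> \<open>The norms of q and \<open>I1\<close> control these functions only for times in
    \<open>{0..T}\<close>.\<close>
  have time: "real k * dt \<in> {0..T}" if "real k \<le> T / dt" for k
    using that dt by (simp add: field_simps)
  have inflow_in: "(?x i j, grid_dir d\<theta> n) \<in> inflow L1 L2"
    if "(i, j, n) \<in> grid_on dx1 dx2 d\<theta> M (inflow L1 L2)" for i j n
    using that by (simp add: grid_on_def)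
  have r: "0 \<le> c (?x i j) * dt" "c (?x i j) * dt \<le> cp * dt" "0 \<le> \<mu>s (?x i j)" "0 \<le> \<mu>a (?x i j)"
    if "(i, j, n) \<in> ?X" for i j n
    using coeff inX(1)[OF that] dt c_le by (auto intro: less_imp_le)
  \<comment> \<open>The bound grows with the elapsed time k dt, since each step adds at most cp Q
    dt; T replaces k dt only at the end. The sum of \<open>N0\<close> and \<open>N1\<close>
    dominates both initial and inflow values.\<close>
  have bound: "\<bar>I k i j n\<bar> \<le> N0 + N1 + cp * Q * (real k * dt)"
    if "real k \<le> T / dt" "(i, j, n) \<in> ?G" for k i j n
    using that
  proof (induction k arbitrary: i j n)
    case 0
    then consider "(i, j, n) \<in> ?X" | "(i, j, n) \<in> grid_on dx1 dx2 d\<theta> M (inflow L1 L2)"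
      using G_cases by blast
    then show ?case
    proof cases
      case 1
      then show ?thesis using init I0_le[OF inX(3)[OF 1]] N by simp
    next
      case 2
      then show ?thesis using bdry I1_le[OF time inflow_in[OF 2], OF 0(1)] 0(1) N by force
    qed
  next
    case (Suc k)
    then consider "(i, j, n) \<in> ?X" | "(i, j, n) \<in> grid_on dx1 dx2 d\<theta> M (inflow L1 L2)"
      using G_cases by blast
    then show ?case
    proof cases
      case X: 1
      have k: "real k \<le> T / dt" using Suc.prems(1) by simp
      note IH = Suc.IH[OF k]
      obtain i' j' where nb: "(i', j, n) \<in> ?G" "(i, j', n) \<in> ?G" and eq:
        "(1 + c (?x i j) * dt * (\<mu>s (?x i j) + \<mu>a (?x i j))) * I (Suc k) i j n =
        (1 - a1 i j n - a2 i j n) * I k i j n + a1 i j n * I k i' j n + a2 i j n * I k i j' n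
        + c (?x i j) * dt * \<mu>s (?x i j) * (\<Sum>\<nu><M. \<kappa> i j n \<nu> * I k i j \<nu>)
        + c (?x i j) * dt * q (real k * dt) (?x i j) (grid_dir d\<theta> n)"
        using step[OF X Suc.prems(1)] by blast
      have "\<bar>I (Suc k) i j n\<bar> \<le> N0 + N1 + cp * Q * (real k * dt) + c (?x i j) * dt * Q"
        by (rule implicit_step_bound[OF eq r(1)[OF X] r(3)[OF X] r(4)[OF X] a[OF X]
              \<kappa>_nonneg[OF X] \<kappa>_sum[OF X] IH[OF Suc.prems(2)] IH[OF nb(1)] IH[OF nb(2)]
              IH[OF XG[OF X]] q_le[OF time[OF k] inX(3)[OF X]]])
      also have "c (?x i j) * dt * Q \<le> cp * dt * Q"
        by (rule mult_right_mono[OF r(2)[OF X] N(3)])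
      finally show ?thesis by (simp add: algebra_simps)
    next
      case 2
      \<comment> \<open>Inflow values are at most \<open>N1\<close> at every level, so nonnegativity
        of the remaining terms is enough.\<close>
      have "cp * Q * (real (Suc k) * dt) \<ge> 0"
        using \<open>cp > 0\<close> N dt by (intro mult_nonneg_nonneg) auto
      moreover have "I (Suc k) i j n = I1 (real (Suc k) * dt) (?x i j) (grid_dir d\<theta> n)"
        using bdry 2 Suc.prems(1) by blast
      ultimately show ?thesis
        using I1_le[OF time inflow_in[OF 2], OF Suc.prems(1)] N by simp
    qed
  qed
  have sup_bound: "sup_norm ?G (\<lambda>(i, j, n). I k i j n) \<le> N0 + N1 + cp * Q * T"
    if k: "real k \<le> T / dt" for k
  proof (rule sup_norm_least)
    show "N0 + N1 + cp * Q * T \<ge> 0" using N T \<open>cp > 0\<close> by auto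
    fix s assume "s \<in> ?G"
    moreover obtain i j n where s: "s = (i, j, n)" by (metis surj_pair)
    ultimately have "\<bar>I k i j n\<bar> \<le> N0 + N1 + cp * Q * (real k * dt)" using bound[OF k] by simp
    also have "cp * Q * (real k * dt) \<le> cp * Q * T"
      using time[OF k] N \<open>cp > 0\<close> by (intro mult_left_mono) auto
    finally show "\<bar>case s of (i, j, n) \<Rightarrow> I k i j n\<bar> \<le> N0 + N1 + cp * Q * T" using s by simp
  qed

  \<comment> \<open>Positivity, by the same induction\<close>
  have positive: "I k i j n \<ge> 0"
    if q: "\<forall>(t, x, \<xi>) \<in> {0..T} \<times> phase_space L1 L2. q t x \<xi> \<ge> 0"
      and I0: "\<forall>(x, \<xi>) \<in> phase_space L1 L2. I0 x \<xi> \<ge> 0"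
      and I1: "\<forall>(t, x, \<xi>) \<in> {0..T} \<times> inflow L1 L2. I1 t x \<xi> \<ge> 0"
      and "real k \<le> T / dt" "(i, j, n) \<in> ?G" for k i j n
    using that(4,5)
  proof (induction k arbitrary: i j n)
    case 0
    then consider "(i, j, n) \<in> ?X" | "(i, j, n) \<in> grid_on dx1 dx2 d\<theta> M (inflow L1 L2)"
      using G_cases by blast
    then show ?case
    proof cases
      case 1
      then show ?thesis using init I0 inX(3)[OF 1] by auto
    next
      case 2
      then have "I 0 i j n = I1 (real 0 * dt) (?x i j) (grid_dir d\<theta> n)" using bdry 0(1) by blast
      then show ?thesis using I1 time[OF 0(1)] inflow_in[OF 2] by auto
    qed
  next
    case (Suc k)
    then consider "(i, j, n) \<in> ?X" | "(i, j, n) \<in> grid_on dx1 dx2 d\<theta> M (inflow L1 L2)"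
      using G_cases by blast
    then show ?case
    proof cases
      case X: 1
      have k: "real k \<le> T / dt" using Suc.prems(1) by simp
      note IH = Suc.IH[OF k]
      obtain i' j' where nb: "(i', j, n) \<in> ?G" "(i, j', n) \<in> ?G" and eq:
        "(1 + c (?x i j) * dt * (\<mu>s (?x i j) + \<mu>a (?x i j))) * I (Suc k) i j n =
        (1 - a1 i j n - a2 i j n) * I k i j n + a1 i j n * I k i' j n + a2 i j n * I k i j' n
        + c (?x i j) * dt * \<mu>s (?x i j) * (\<Sum>\<nu><M. \<kappa> i j n \<nu> * I k i j \<nu>)
        + c (?x i j) * dt * q (real k * dt) (?x i j) (grid_dir d\<theta> n)"
        using step[OF X Suc.prems(1)] by blast
      have q_nonneg: "q (real k * dt) (?x i j) (grid_dir d\<theta> n) \<ge> 0"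
        using q time[OF k] inX(3)[OF X] by auto
      show ?thesis
        by (rule implicit_step_nonneg[OF eq r(1)[OF X] r(3)[OF X] r(4)[OF X] a[OF X]
              \<kappa>_nonneg[OF X] IH[OF Suc.prems(2)] IH[OF nb(1)] IH[OF nb(2)] IH[OF XG[OF X]]
              q_nonneg])
    next
      case 2
      then have "I (Suc k) i j n = I1 (real (Suc k) * dt) (?x i j) (grid_dir d\<theta> n)"
        using bdry Suc.prems(1) by blast
      then show ?thesis using I1 time[OF Suc.prems(1)] inflow_in[OF 2] by auto
    qed
  qed
  show ?thesis
    using sup_bound positive unfolding N0_def N1_def Q_def by blast
qed

end
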